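(* Let $(S,\mathcal{C})$ be a connectoid and let $U\subseteq S$ be a set that is contained in a normal tree of $(S,\mathcal{C})$. Then for every connected minor $(S'',\mathcal{C}'')$ of $(S,\mathcal{C})$ there is a normal tree of $(S'',\mathcal{C}'')$ that contains $\{s\in S'': s\cap U\neq\emptyset\}$. (Elements of $S''$ are subsets of $S$.)
   Context: Connectoids: let $S$ be a set and let $\mathcal{F}$ be a set of finite subsets of $S$ such that (i) $F\cup F'\in\mathcal{F}$ whenever $F,F'\in\mathcal{F}$ and $F\cap F'\neq\emptyset$, and (ii) $\emptyset\in\mathcal{F}$ and $\{s\}\in\mathcal{F}$ for every $s\in S$. A subset $C\subseteq S$ is connected if for every $x,y\in C$ there is $F\in\mathcal{F}$ with $F\subseteq C$ and $x,y\in F$. The pair $(S,\mathcal{C})$, where $\mathcal{C}$ is the set of connected subsets of $S$, is the connectoid induced by $\mathcal{F}$; a connectoid is any pair arising in this way. It is connected if $S\in\mathcal{C}$. Minors: a connectoid $(S',\mathcal{C}')$ is a subconnectoid of $(S,\mathcal{C})$ if $S'\subseteq S$ and $\mathcal{C}'\subseteq\mathcal{C}$. Given a connectoid $(S',\mathcal{C}')$ and a partition $\mathcal{P}$ of $S'$ into elements of $\mathcal{C}'$, the connectoid $(\mathcal{P},\{X\subseteq\mathcal{P}:\bigcup X\in\mathcal{C}'\})$ is said to be obtained from $(S',\mathcal{C}')$ by contracting $\mathcal{P}$. A connectoid $(S'',\mathcal{C}'')$ is a minor of $(S,\mathcal{C})$ if there is a subconnectoid $(S',\mathcal{C}')$ of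 $(S,\mathcal{C})$ such that $S''$ is a partition of $S'$ into elements of $\mathcal{C}'$ and $(S'',\mathcal{C}'')$ is obtained from $(S',\mathcal{C}')$ by contracting $S''$. Necklaces: with $\mathbb{N}=\{1,2,3,\dots\}$, a connected set $N$ is a necklace if there is a family $(H_n)_{n\in\mathbb{N}}$ of finite connected sets with $N=\bigcup_{n}H_n$ such that, for all $i,j\in\mathbb{N}$, $H_i\cap H_j\neq\emptyset$ if and only if $|i-j|\leq 1$. Normal trees: $\leq_T$ denotes the tree-order of a rooted tree $T$. A weak normal tree of $(S,\mathcal{C})$ is a rooted undirected tree $T$ with $V(T)\subseteq S$ such that (a) for every $C\in\mathcal{C}$ and every two $\leq_T$-incomparable $u,v\in C\cap V(T)$ there is $w\in C$ with $w\leq_T u,v$, and (b) for every $u\leq_T v$ in $V(T)$ there is $C\in\mathcal{C}$ with $u,v\in C$ that contains no $w<_T u$. A weak normal tree $T$ is a normal tree if moreover for every ray $R$ in $T$ starting at the root there is a necklace containing all but finitely many elements of $V(R)$. A tree contains a set $U$ if $U\subseteq V(T)$. *)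

theory Defs
  imports "HOL-Library.Disjoint_Sets"
begin

definition generates_connectoid :: "'a set \<Rightarrow> 'a set set \<Rightarrow> bool" where
  "generates_connectoid S \<F> \<longleftrightarrow>
     (\<forall>F\<in>\<F>. finite F \<and> F \<subseteq> S) \<and>
     (\<forall>F\<in>\<F>. \<forall>F'\<in>\<F>. F \<inter> F' \<noteq> {} \<longrightarrow> F \<union> F' \<in> \<F>) \<and>
     {} \<in> \<F> \<and> (\<forall>s\<in>S. {s} \<in> \<F>)"

definition connected_sets :: "'a set \<Rightarrow> 'a set set \<Rightarrow> 'a set set" where
  "connected_sets S \<F> =
     {C. C \<subseteq> S \<and> (\<forall>x\<in>C. \<forall>y\<in>C. \<exists>F\<in>\<F>. F \<subseteq> C \<and> x \<in> F \<and> y \<in> F)}"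

definition connectoid :: "'a set \<Rightarrow> 'a set set \<Rightarrow> bool" where
  "connectoid S \<C> \<longleftrightarrow> (\<exists>\<F>. generates_connectoid S \<F> \<and> \<C> = connected_sets S \<F>)"

definition connected_connectoid :: "'a set \<Rightarrow> 'a set set \<Rightarrow> bool" where
  "connected_connectoid S \<C> \<longleftrightarrow> connectoid S \<C> \<and> S \<in> \<C>"

definition subconnectoid :: "'a set \<Rightarrow> 'a set set \<Rightarrow> 'a set \<Rightarrow> 'a set set \<Rightarrow> bool" where
  "subconnectoid S' \<C>' S \<C> \<longleftrightarrow> connectoid S' \<C>' \<and> connectoid S \<C> \<and> S' \<subseteq> S \<and> \<C>' \<subseteq> \<C>"

text \<open>The connected sets of the connectoid on \<open>P\<close> obtained by contracting the partition \<open>P\<close>.\<close>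

definition contracted_sets :: "'a set set \<Rightarrow> 'a set set \<Rightarrow> 'a set set set" where
  "contracted_sets \<C> P = {X. X \<subseteq> P \<and> \<Union>X \<in> \<C>}"

definition is_minor :: "'a set set \<Rightarrow> 'a set set set \<Rightarrow> 'a set \<Rightarrow> 'a set set \<Rightarrow> bool" where
  "is_minor S'' \<C>'' S \<C> \<longleftrightarrow> connectoid S'' \<C>'' \<and>
     (\<exists>S' \<C>'. subconnectoid S' \<C>' S \<C> \<and> partition_on S' S'' \<and> S'' \<subseteq> \<C>' \<and>
        \<C>'' = contracted_sets \<C>' S'')"

text \<open>The sequence is indexed from 0; the condition only involves differences of indices.\<close>

definition necklace :: "'a set set \<Rightarrow> 'a set \<Rightarrow> bool" where
  "necklace \<C> N \<longleftrightarrow> N \<in> \<C> \<and>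
     (\<exists>H :: nat \<Rightarrow> 'a set. (\<forall>n. finite (H n) \<and> H n \<in> \<C>) \<and> N = (\<Union>n. H n) \<and>
        (\<forall>i j. H i \<inter> H j \<noteq> {} \<longleftrightarrow> \<bar>int i - int j\<bar> \<le> 1))"

text \<open>
  Undirected simple graphs, possibly infinite, with a distinguished vertex. Edges are
  two-element vertex sets. A rooted tree is non-empty, since it contains its root.
\<close>

record 'a rooted_graph =
  verts :: "'a set"
  edges :: "'a set set"
  root :: 'a

definition graph_path :: "'a rooted_graph \<Rightarrow> 'a \<Rightarrow> 'a list \<Rightarrow> 'a \<Rightarrow> bool" where
  "graph_path T u p v \<longleftrightarrow> p \<noteq> [] \<and> hd p = u \<and> last p = v \<and> distinct p \<and>
     set p \<subseteq> verts T \<and> successively (\<lambda>x y. {x, y} \<in> edges T) p"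

definition graph_cycle :: "'a rooted_graph \<Rightarrow> 'a list \<Rightarrow> bool" where
  "graph_cycle T p \<longleftrightarrow> length p \<ge> 3 \<and> graph_path T (hd p) p (last p) \<and> {last p, hd p} \<in> edges T"

definition rooted_tree :: "'a rooted_graph \<Rightarrow> bool" where
  "rooted_tree T \<longleftrightarrow>
     root T \<in> verts T \<and>
     (\<forall>e\<in>edges T. e \<subseteq> verts T \<and> card e = 2) \<and>
     (\<forall>u\<in>verts T. \<forall>v\<in>verts T. \<exists>p. graph_path T u p v) \<and>
     (\<nexists>p. graph_cycle T p)"

text \<open>
  The tree-order: \<open>u\<close> lies on the path from the root to \<open>v\<close>, which is unique in a tree.
  Related elements are always vertices.
\<close>

definition tree_le :: "'a rooted_graph \<Rightarrow> 'a \<Rightarrow> 'a \<Rightarrow> bool" where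
  "tree_le T u v \<longleftrightarrow> (\<exists>p. graph_path T (root T) p v \<and> u \<in> set p)"

definition tree_less :: "'a rooted_graph \<Rightarrow> 'a \<Rightarrow> 'a \<Rightarrow> bool" where
  "tree_less T u v \<longleftrightarrow> tree_le T u v \<and> u \<noteq> v"

definition root_ray :: "'a rooted_graph \<Rightarrow> (nat \<Rightarrow> 'a) \<Rightarrow> bool" where
  "root_ray T R \<longleftrightarrow> inj R \<and> range R \<subseteq> verts T \<and> R 0 = root T \<and> (\<forall>n. {R n, R (Suc n)} \<in> edges T)"

definition weak_normal_tree :: "'a set \<Rightarrow> 'a set set \<Rightarrow> 'a rooted_graph \<Rightarrow> bool" where
  "weak_normal_tree S \<C> T \<longleftrightarrow>
     rooted_tree T \<and> verts T \<subseteq> S \<and>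
     (\<forall>C\<in>\<C>. \<forall>u\<in>C \<inter> verts T. \<forall>v\<in>C \<inter> verts T.
        \<not> tree_le T u v \<and> \<not> tree_le T v u \<longrightarrow> (\<exists>w\<in>C. tree_le T w u \<and> tree_le T w v)) \<and>
     (\<forall>u\<in>verts T. \<forall>v\<in>verts T. tree_le T u v \<longrightarrow>
        (\<exists>C\<in>\<C>. u \<in> C \<and> v \<in> C \<and> (\<nexists>w. w \<in> C \<and> tree_less T w u)))"

definition normal_tree :: "'a set \<Rightarrow> 'a set set \<Rightarrow> 'a rooted_graph \<Rightarrow> bool" where
  "normal_tree S \<C> T \<longleftrightarrow> weak_normal_tree S \<C> T \<and>
     (\<forall>R. root_ray T R \<longrightarrow> (\<exists>N. necklace \<C> N \<and> finite (range R - N)))"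

end

(* Every connected set C that meets a weak normal tree T has a least vertex in the tree order, and
   a vertex u has only finitely many vertices below it. So the least vertices of the connected sets
   containing u form a finite set. This survives in a minor: send a connected set of parts to the
   part mu C that contains the least vertex of its union.

   Build the new tree downwards. The children of a node t with component D lie one in each component
   of D - t. At even levels the vertex mu D of the current component D is picked; an element of U
   that stayed in D forever would lie below infinitely many distinct values of mu, so U is used up.
   A tree built in this way is weakly normal whatever is picked. To obtain necklaces as well, choose
   for each pair of consecutive nodes t, t' on a branch a finite connected set in D containing both,
   and use the odd levels to pick the elements of these links that are still in the current
   component. Along a ray every point is then in only finitely many links, and the links, grouped
   into consecutive blocks, form a necklace that contains the ray. *)

theory Submission
  imports Defs
begin

section \<open>Rooted trees\<close>

lemma graph_path_rev:
  "graph_path T u p v \<Longrightarrow> graph_path T v (rev p) u"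
  by (auto simp: graph_path_def hd_rev last_rev insert_commute)

lemma graph_path_prefix:
  assumes "graph_path T u (p @ x # q) v"
  shows "graph_path T u (p @ [x]) x"
  using assms by (auto simp: graph_path_def hd_append successively_append_iff split: if_splits)

lemma graph_path_extend:
  assumes p: "graph_path T u p v" and e: "{v, w} \<in> edges T" and w: "w \<in> verts T"
  shows "\<exists>q. graph_path T u q w"
proof (cases "w \<in> set p")
  case True
  then obtain a b where "p = a @ w # b" by (meson split_list)
  with p show ?thesis by (blast dest: graph_path_prefix)
next
  case False
  with assms have "graph_path T u (p @ [w]) w"
    by (auto simp: graph_path_def successively_append_iff)
  then show ?thesis ..
qed

text \<open>Strip the common beginning of the two paths. Where they diverge, the first path can be
  followed to its first vertex on the second and the second one back, which gives a cycle.\<close>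

lemma graph_path_unique:
  assumes acyclic: "\<nexists>c. graph_cycle T c"
    and "graph_path T u p v" "graph_path T u q v"
  shows "p = q"
  using assms(2,3)
proof (induction p arbitrary: u q)
  case Nil
  then show ?case by (simp add: graph_path_def)
next
  case (Cons x p)
  have x: "x = u" using Cons.prems(1) by (simp add: graph_path_def)
  obtain q' where q: "q = u # q'"
    using Cons.prems(2) by (cases q) (auto simp: graph_path_def)
  show ?case
  proof (cases "p = [] \<or> q' = []")
    case True
    with Cons.prems x q show ?thesis
      by (auto simp: graph_path_def split: if_splits)
  next
    case False
    then obtain a ps b qs where p: "p = a # ps" and q': "q' = b # qs"
      by (meson list.exhaust)
    have pa: "graph_path T a p v" and qb: "graph_path T b q' v"
      using Cons.prems x q p q' by (auto simp: graph_path_def)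
    have ua: "{u, a} \<in> edges T" and ub: "{u, b} \<in> edges T"
      using Cons.prems x q p q' by (auto simp: graph_path_def)
    show ?thesis
    proof (cases "a = b")
      case True
      then show ?thesis using Cons.IH[OF pa] qb x q by simp
    next
      case False
      have "v \<in> set p" "v \<in> set q'"
        using pa qb unfolding graph_path_def by (metis last_in_set)+
      then obtain ys y zs where ys: "p = ys @ y # zs" "y \<in> set q'" "\<forall>z\<in>set ys. z \<notin> set q'"
        using split_list_first_prop[of p "\<lambda>z. z \<in> set q'"] by blast
      then obtain ys' zs' where ys': "q' = ys' @ y # zs'"
        by (meson split_list)
      \<comment> \<open>The cycle goes from \<open>u\<close> along \<open>p\<close> to the meeting
        point \<open>y\<close> and back along \<open>q'\<close> to \<open>b\<close>; the edge
        between \<open>u\<close> and \<open>b\<close> closes it.\<close>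
      define c where "c = u # ys @ y # rev ys'"
      have uq: "u \<notin> set q'" "u \<notin> set p" "u \<in> verts T"
        using Cons.prems x q by (auto simp: graph_path_def)
      have sp: "successively (\<lambda>x y. {x, y} \<in> edges T) (u # ys @ [y])"
        using Cons.prems(1) x ys(1)
        by (auto simp: graph_path_def successively_append_iff successively_Cons hd_append split: if_splits)
      have sq: "successively (\<lambda>x y. {x, y} \<in> edges T) (y # rev ys')"
        using qb ys'
        by (auto simp: graph_path_def successively_append_iff successively_Cons hd_rev insert_commute)
      have sc: "successively (\<lambda>x y. {x, y} \<in> edges T) c"
        using sp sq unfolding c_def
        by (auto simp: successively_append_iff successively_Cons hd_append split: if_splits)
      have dc: "distinct c"
        using pa qb uq ys ys' unfolding c_def graph_path_def by auto
      have vc: "set c \<subseteq> verts T"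
        using pa qb uq ys ys' unfolding c_def graph_path_def by auto
      have last: "last c = b"
        using ys' q' unfolding c_def by (cases ys') auto
      \<comment> \<open>If both were empty, \<open>y\<close> would equal both \<open>a\<close> and
        \<open>b\<close>. Hence the cycle has at least three vertices.\<close>
      have "ys \<noteq> [] \<or> ys' \<noteq> []"
        using False p q' ys ys' by auto
      then have "length c \<ge> 3"
        unfolding c_def by (cases ys; cases ys') auto
      then have "graph_cycle T c"
        using sc dc vc last ub unfolding graph_cycle_def graph_path_def
        by (auto simp: c_def insert_commute)
      with acyclic show ?thesis by blast
    qed
  qed
qed

section \<open>Finite down-sets and least vertices in the tree-order\<close>

lemma rooted_tree_finite_below:
  assumes "rooted_tree T"
  shows "finite {u. tree_le T u v}"
proof (cases "\<exists>p. graph_path T (root T) p v")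
  case True
  then obtain p where "graph_path T (root T) p v" ..
  moreover have "\<nexists>c. graph_cycle T c" using assms by (simp add: rooted_tree_def)
  ultimately have "q = p" if "graph_path T (root T) q v" for q
    using that graph_path_unique by metis
  then have "{u. tree_le T u v} \<subseteq> set p" by (auto simp: tree_le_def)
  then show ?thesis by (rule finite_subset) simp
qed (auto simp: tree_le_def)

text \<open>Take a vertex \<open>m\<close> of \<open>C\<close> whose root path is shortest. For any
  other vertex \<open>v\<close> of \<open>C\<close>, condition (a) or comparability gives a vertex
  of \<open>C\<close> below both; by minimality it is \<open>m\<close> itself.\<close>

lemma weak_normal_tree_connected_least:
  assumes T: "weak_normal_tree S \<C> T" and C: "C \<in> \<C>" "C \<inter> verts T \<noteq> {}"
  shows "\<exists>m\<in>C \<inter> verts T. \<forall>v\<in>C \<inter> verts T. tree_le T m v"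
proof -
  have tree: "rooted_tree T" using T by (simp add: weak_normal_tree_def)
  then have acyclic: "\<nexists>c. graph_cycle T c" by (simp add: rooted_tree_def)
  obtain P where P: "\<And>v. v \<in> verts T \<Longrightarrow> graph_path T (root T) (P v) v"
    using tree unfolding rooted_tree_def by metis
  have le: "u \<in> verts T \<and> u \<in> set (P v)" if "tree_le T u v" "v \<in> verts T" for u v
  proof -
    from that(1) obtain p where p: "graph_path T (root T) p v" "u \<in> set p"
      unfolding tree_le_def by blast
    have "p = P v" by (rule graph_path_unique[OF acyclic p(1) P[OF that(2)]])
    with p show ?thesis by (auto simp: graph_path_def)
  qed
  \<comment> \<open>The length of the root path is a strict rank for the tree-order.\<close>
  have shorter: "u = v \<or> length (P u) < length (P v)" if uv: "tree_le T u v" "v \<in> verts T" for u v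
  proof -
    from le[OF uv] obtain a b where ab: "P v = a @ u # b" by (meson split_list)
    have "graph_path T (root T) (a @ [u]) u"
      using P[OF uv(2)] ab by (auto intro: graph_path_prefix)
    then have "P u = a @ [u]"
      using graph_path_unique[OF acyclic P[of u]] le[OF uv] by simp
    moreover have "b = [] \<Longrightarrow> u = v"
      using P[OF uv(2)] ab by (simp add: graph_path_def)
    ultimately show ?thesis using ab by (cases b) auto
  qed
  obtain m where m: "m \<in> C \<inter> verts T" and min: "\<And>v. v \<in> C \<inter> verts T \<Longrightarrow> length (P m) \<le> length (P v)"
    using C(2) ex_has_least_nat[of "\<lambda>v. v \<in> C \<inter> verts T" _ "\<lambda>v. length (P v)"] by blast
  have "tree_le T m v" if v: "v \<in> C \<inter> verts T" for v
  proof (rule ccontr)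
    assume not: "\<not> tree_le T m v"
    have "\<exists>w\<in>C. tree_le T w m \<and> tree_le T w v"
    proof (cases "tree_le T v m")
      case True
      have "tree_le T v v"
        using P v unfolding tree_le_def graph_path_def by (metis IntD2 last_in_set)
      with True v show ?thesis by blast
    next
      case False
      with not T C(1) m v show ?thesis unfolding weak_normal_tree_def by blast
    qed
    then obtain w where w: "w \<in> C" "tree_le T w m" "tree_le T w v" by blast
    then have "w \<in> C \<inter> verts T" using le m by blast
    then have "w = m" using shorter[OF w(2)] min[of w] m by auto
    with w not show False by simp
  qed
  with m show ?thesis by blast
qed

section \<open>Trees presented by their root paths\<close>

locale path_system =
  fixes V :: "'a set" and r :: 'a and P :: "'a \<Rightarrow> 'a list"
  assumes root_in: "r \<in> V" and P_root: "P r = [r]"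
    and P_step: "\<And>v. v \<in> V \<Longrightarrow> v \<noteq> r \<Longrightarrow> \<exists>u\<in>V. P v = P u @ [v]"
    and distinct_P: "\<And>v. v \<in> V \<Longrightarrow> distinct (P v)"
begin

definition tree :: "'a rooted_graph" where
  "tree = \<lparr>verts = V, edges = {{u, v} | u v. u \<in> V \<and> v \<in> V \<and> P v = P u @ [v]}, root = r\<rparr>"

lemma tree_simps [simp]: "verts tree = V" "root tree = r"
  by (simp_all add: tree_def)

lemma last_P: "v \<in> V \<Longrightarrow> P v \<noteq> [] \<and> last (P v) = v"
  using P_root P_step by (cases "v = r") force+

lemma edge_iff: "{u, v} \<in> edges tree \<longleftrightarrow> u \<in> V \<and> v \<in> V \<and> (P v = P u @ [v] \<or> P u = P v @ [u])"
  by (auto simp: tree_def doubleton_eq_iff)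

lemma path_root: "v \<in> V \<Longrightarrow> graph_path tree r (P v) v"
proof (induction "length (P v)" arbitrary: v rule: less_induct)
  case less
  show ?case
  proof (cases "v = r")
    case True
    then show ?thesis using root_in P_root by (simp add: graph_path_def)
  next
    case False
    then obtain u where u: "u \<in> V" "P v = P u @ [v]" using P_step less.prems by blast
    then have "graph_path tree r (P u) u" using less.hyps by simp
    then show ?thesis
      using u less.prems distinct_P[OF less.prems]
      by (auto simp: graph_path_def successively_append_iff edge_iff)
  qed
qed

text \<open>By induction the path without its last vertex is \<open>P (last q)\<close>. If the last
  edge led back towards the root, \<open>v\<close> would already lie on \<open>q\<close>.\<close>

lemma path_root_unique: "graph_path tree r p v \<Longrightarrow> p = P v"
proof (induction p arbitrary: v rule: rev_induct)
  case Nil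
  then show ?case by (simp add: graph_path_def)
next
  case (snoc x q)
  then have x: "x = v" by (simp add: graph_path_def)
  show ?case
  proof (cases "q = []")
    case True
    then show ?thesis using snoc.prems P_root by (auto simp: graph_path_def)
  next
    case False
    then have "graph_path tree r q (last q)" and e: "{last q, v} \<in> edges tree" and v: "v \<notin> set q"
      using snoc.prems x by (auto simp: graph_path_def successively_append_iff)
    then have q: "q = P (last q)" using snoc.IH by blast
    have "P (last q) \<noteq> P v @ [last q]"
      using v q last_P[of v] e unfolding edge_iff by (metis in_set_conv_decomp last_in_set Un_iff set_append)
    then show ?thesis using e q x unfolding edge_iff by metis
  qed
qed

lemma tree_le_iff: "tree_le tree u v \<longleftrightarrow> v \<in> V \<and> u \<in> set (P v)"
proof
  assume "tree_le tree u v"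
  then obtain p where p: "graph_path tree r p v" "u \<in> set p" by (auto simp: tree_le_def)
  then have "v \<in> V" by (auto simp: graph_path_def)
  with p path_root_unique show "v \<in> V \<and> u \<in> set (P v)" by blast
qed (use path_root in \<open>auto simp: tree_le_def\<close>)

text \<open>On a cycle, take a vertex whose root path is longest. Both of its neighbours on the
  cycle must be its parent, so they coincide.\<close>

lemma acyclic: "\<not> graph_cycle tree c"
proof
  assume c: "graph_cycle tree c"
  define n where "n = length c"
  have n: "n \<ge> 3" and dist: "distinct c" and close: "{last c, hd c} \<in> edges tree"
    and succ: "\<And>i. Suc i < n \<Longrightarrow> {c ! i, c ! Suc i} \<in> edges tree"
    using c by (auto simp: graph_cycle_def graph_path_def n_def successively_conv_nth)
  have close': "{c ! (n - 1), c ! 0} \<in> edges tree"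
    using close n by (metis hd_conv_nth last_conv_nth length_0_conv n_def not_numeral_le_zero)
  obtain i where i: "i < n" and max: "\<And>j. j < n \<Longrightarrow> length (P (c ! j)) \<le> length (P (c ! i))"
  proof -
    let ?L = "(\<lambda>i. length (P (c ! i))) ` {..<n}"
    have "Max ?L \<in> ?L" using n by (intro Max_in) (auto simp: lessThan_empty_iff)
    moreover have "length (P (c ! j)) \<le> Max ?L" if "j < n" for j using that by simp
    ultimately show ?thesis using that by force
  qed
  have nb: "P (c ! i) = P (c ! j) @ [c ! i]" "c ! j \<in> V" if "j < n" "{c ! i, c ! j} \<in> edges tree" for j
    using that max[of j] by (auto simp: edge_iff)
  \<comment> \<open>These are the two cyclic neighbours of position \<open>i\<close>, with
    wrap-around at both ends of the list; they differ because \<open>n \<ge> 3\<close>.\<close>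
  obtain j k where jk: "j < n" "k < n" "j \<noteq> k"
    and e: "{c ! i, c ! j} \<in> edges tree" "{c ! i, c ! k} \<in> edges tree"
  proof (cases "i = 0")
    case True
    then show ?thesis
      using that[of 1 "n - 1"] n succ[of 0] close' by (auto simp: insert_commute)
  next
    case False
    show ?thesis
    proof (cases "i = n - 1")
      case True
      then show ?thesis
        using that[of 0 "n - 2"] n succ[of "n - 2"] close' False
        by (auto simp: insert_commute Suc_diff_Suc numeral_2_eq_2 numeral_3_eq_3)
    next
      case False
      then show ?thesis
        using that[of "i - 1" "Suc i"] n succ[of "i - 1"] succ[of i] i \<open>i \<noteq> 0\<close>
        by (auto simp: insert_commute)
    qed
  qed
  have "P (c ! j) = P (c ! k)" using nb(1)[of j] nb(1)[of k] jk e by auto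
  then have "c ! j = c ! k" using last_P nb(2) jk e by metis
  with jk dist show False by (simp add: nth_eq_iff_index_eq n_def)
qed

lemma rooted_tree: "rooted_tree tree"
proof -
  have edge: "e \<subseteq> V \<and> card e = 2" if "e \<in> edges tree" for e
  proof -
    from that obtain u v where uv: "e = {u, v}" "u \<in> V" "v \<in> V" "P v = P u @ [v]"
      by (auto simp: tree_def)
    then have "u \<noteq> v" by auto
    with uv show ?thesis by simp
  qed
  \<comment> \<open>Descend from \<open>u\<close> to the root, then climb towards \<open>v\<close>;
    \<open>graph_path_extend\<close> cuts the path back whenever it would revisit a vertex.\<close>
  have path: "\<exists>p. graph_path tree u p v" if u: "u \<in> V" and v: "v \<in> V" for u v
    using v
  proof (induction "length (P v)" arbitrary: v rule: less_induct)
    case less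
    show ?case
    proof (cases "v = r")
      case True
      then show ?thesis using graph_path_rev[OF path_root[OF u]] by blast
    next
      case False
      then obtain w where w: "w \<in> V" "P v = P w @ [v]" using P_step less.prems by blast
      then obtain p where "graph_path tree u p w" using less.hyps[of w] by auto
      then show ?thesis using graph_path_extend w less.prems by (fastforce simp: edge_iff)
    qed
  qed
  show ?thesis
    unfolding rooted_tree_def using edge path root_in acyclic by auto
qed

text \<open>Each new vertex of the ray lies off the root path of its predecessor, so the edge to it
  can only lead away from the root.\<close>

lemma P_root_ray:
  assumes "root_ray tree R"
  shows "P (R n) = map R [0..<Suc n]"
proof (induction n)
  case 0
  then show ?case using assms P_root by (simp add: root_ray_def)
next
  case (Suc n)
  have "R (Suc n) \<notin> set (P (R n))"
    using assms Suc by (auto simp: root_ray_def inj_eq)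
  moreover have "{R n, R (Suc n)} \<in> edges tree" using assms by (simp add: root_ray_def)
  ultimately have "P (R (Suc n)) = P (R n) @ [R (Suc n)]"
    using last_P[of "R (Suc n)"] unfolding edge_iff
    by (metis Un_iff last_in_set set_append)
  then show ?case using Suc by simp
qed

end

section \<open>Connectoids\<close>

lemma connectoid_subset: "connectoid S \<C> \<Longrightarrow> C \<in> \<C> \<Longrightarrow> C \<subseteq> S"
  by (auto simp: connectoid_def connected_sets_def)

lemma connectoid_singleton:
  assumes "connectoid S \<C>" "s \<in> S"
  shows "{s} \<in> \<C>"
  using assms by (auto simp: connectoid_def connected_sets_def generates_connectoid_def)

lemma connectoid_finite_link:
  assumes "connectoid S \<C>" "C \<in> \<C>" "x \<in> C" "y \<in> C"
  shows "\<exists>F\<in>\<C>. finite F \<and> F \<subseteq> C \<and> x \<in> F \<and> y \<in> F"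
proof -
  obtain \<F> where F: "generates_connectoid S \<F>" "\<C> = connected_sets S \<F>"
    using assms(1) by (auto simp: connectoid_def)
  have "C \<in> connected_sets S \<F>" using assms(2) F(2) by simp
  then obtain A where A: "A \<in> \<F>" "A \<subseteq> C" "x \<in> A" "y \<in> A"
    using assms(3,4) unfolding connected_sets_def by blast
  then have "finite A" "A \<in> \<C>"
    using F by (auto simp: generates_connectoid_def connected_sets_def)
  with A show ?thesis by blast
qed

text \<open>Two points are each joined to \<open>x\<close> by a generating set inside the union.
  These generating sets meet in \<open>x\<close>, so their union is generating as well.\<close>

lemma connectoid_Union:
  assumes "connectoid S \<C>" "\<A> \<subseteq> \<C>" "\<And>A. A \<in> \<A> \<Longrightarrow> x \<in> A"
  shows "\<Union>\<A> \<in> \<C>"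
proof -
  obtain \<F> where F: "generates_connectoid S \<F>" "\<C> = connected_sets S \<F>"
    using assms(1) by (auto simp: connectoid_def)
  have "\<exists>F\<in>\<F>. F \<subseteq> \<Union>\<A> \<and> y \<in> F \<and> z \<in> F" if "A \<in> \<A>" "y \<in> A" "B \<in> \<A>" "z \<in> B" for y z A B
  proof -
    have "\<exists>F\<in>\<F>. F \<subseteq> A \<and> x \<in> F \<and> y \<in> F" "\<exists>F\<in>\<F>. F \<subseteq> B \<and> x \<in> F \<and> z \<in> F"
      using that assms F(2) by (auto simp: connected_sets_def subset_iff)
    then obtain F G where FG: "F \<in> \<F>" "F \<subseteq> A" "x \<in> F" "y \<in> F" "G \<in> \<F>" "G \<subseteq> B" "x \<in> G" "z \<in> G"
      by blast
    have "F \<union> G \<in> \<F>"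
      using F(1) FG(1,5) FG(3,7) unfolding generates_connectoid_def by blast
    moreover have "F \<union> G \<subseteq> \<Union>\<A>" using FG that by blast
    ultimately show ?thesis using FG by blast
  qed
  moreover have "\<Union>\<A> \<subseteq> S" using connectoid_subset[OF assms(1)] assms(2) by blast
  ultimately show ?thesis unfolding F(2) connected_sets_def by blast
qed

lemma connectoid_chain:
  assumes conn: "connectoid S \<C>" and F: "\<And>i. F i \<in> \<C>" "\<And>i::nat. F i \<inter> F (Suc i) \<noteq> {}"
  shows "a < b \<Longrightarrow> (\<Union>i\<in>{a..<b}. F i) \<in> \<C>"
proof (induction b)
  case (Suc b)
  show ?case
  proof (cases "a = b")
    case True
    then show ?thesis using F by simp
  next
    case False
    with Suc have IH: "(\<Union>i\<in>{a..<b}. F i) \<in> \<C>" by simp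
    obtain x where "x \<in> F (b - 1)" "x \<in> F b" using F(2)[of "b - 1"] False Suc.prems by auto
    moreover have "b - 1 \<in> {a..<b}" using False Suc.prems by auto
    ultimately have "\<Union>{(\<Union>i\<in>{a..<b}. F i), F b} \<in> \<C>"
      using IH F(1) by (intro connectoid_Union[OF conn, of _ x]) auto
    moreover have "{a..<Suc b} = insert b {a..<b}" using Suc.prems by auto
    ultimately show ?thesis by (simp add: Un_commute)
  qed
qed simp

text \<open>Sets of the chain that are not consecutive may still meet. Finiteness and
  point-finiteness ensure that late sets avoid any given initial stretch, so consecutive sets can be
  merged into blocks of which only neighbouring ones meet.\<close>

lemma necklace_chain:
  assumes conn: "connectoid S \<C>"
    and F: "\<And>i. finite (F i)" "\<And>i. F i \<in> \<C>" "\<And>i::nat. F i \<inter> F (Suc i) \<noteq> {}"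
    and point_finite: "\<And>x. finite {i. x \<in> F i}"
  shows "necklace \<C> (\<Union>i. F i)"
proof -
  have "\<exists>k>n. \<forall>i\<ge>k. \<forall>j<n. F i \<inter> F j = {}" for n
  proof -
    have "finite (\<Union>x\<in>\<Union>j<n. F j. {i. x \<in> F i})" using F(1) point_finite by blast
    then obtain b where b: "\<And>i. i \<in> (\<Union>x\<in>\<Union>j<n. F j. {i. x \<in> F i}) \<Longrightarrow> i < b"
      unfolding finite_nat_set_iff_bounded by blast
    then have "\<forall>i\<ge>max b (Suc n). \<forall>j<n. F i \<inter> F j = {}" by fastforce
    then show ?thesis by (intro exI[of _ "max b (Suc n)"]) auto
  qed
  then obtain g where g: "\<And>n. n < g n" "\<And>n i j. g n \<le> i \<Longrightarrow> j < n \<Longrightarrow> F i \<inter> F j = {}"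
    by metis
  \<comment> \<open>The block boundaries are the iterates of \<open>g\<close> at 0;
    \<open>n < g n\<close> makes every block non-empty.\<close>
  define k where "k j = (g ^^ j) 0" for j
  have k0: "k 0 = 0" and kSuc: "\<And>j. k (Suc j) = g (k j)" by (simp_all add: k_def)
  have smono: "strict_mono k" using g(1) by (simp add: strict_mono_Suc_iff kSuc)
  define B where "B j = (\<Union>i\<in>{k j..<k (Suc j)}. F i)" for j
  \<comment> \<open>A whole block lies between the two, so the indices in \<open>B j\<close> are at
    least \<open>g (k (Suc i))\<close>, while those in \<open>B i\<close> are below
    \<open>k (Suc i)\<close>.\<close>
  have far: "B i \<inter> B j = {}" if "i + 2 \<le> j" for i j
  proof -
    have "k (Suc (Suc i)) \<le> k j" using smono that by (simp add: strict_mono_less_eq)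
    then have "F b \<inter> F a = {}" if "a < k (Suc i)" "k j \<le> b" for a b
      using that g(2)[of "k (Suc i)" b a] kSuc[of "Suc i"] by simp
    then show ?thesis unfolding B_def by fastforce
  qed
  \<comment> \<open>The last set of one block meets the first set of the next.\<close>
  have near: "B i \<inter> B (Suc i) \<noteq> {}" for i
  proof -
    have "k (Suc i) - 1 \<in> {k i..<k (Suc i)}" "k (Suc i) \<in> {k (Suc i)..<k (Suc (Suc i))}"
      and "Suc (k (Suc i) - 1) = k (Suc i)"
      using g(1)[of "k i"] g(1)[of "k (Suc i)"] by (auto simp: kSuc)
    then show ?thesis using F(3)[of "k (Suc i) - 1"] unfolding B_def by fastforce
  qed
  have "B i \<inter> B j \<noteq> {} \<longleftrightarrow> \<bar>int i - int j\<bar> \<le> 1" for i j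
  proof (cases "\<bar>int i - int j\<bar> \<le> 1")
    case True
    then consider "i = j" | "j = Suc i" | "i = Suc j" by linarith
    then have "B i \<inter> B j \<noteq> {}" using near[of i] near[of j] by cases auto
    with True show ?thesis by simp
  next
    case False
    then have "i + 2 \<le> j \<or> j + 2 \<le> i" by linarith
    then have "B i \<inter> B j = {}" using far by blast
    with False show ?thesis by simp
  qed
  moreover have "finite (B n) \<and> B n \<in> \<C>" for n
    using F connectoid_chain[OF conn, of F "k n" "k (Suc n)"] smono
    by (auto simp: B_def strict_mono_less)
  moreover have "(\<Union>i. F i) = (\<Union>n. B n)"
  proof -
    have "\<exists>j. k j \<le> i \<and> i < k (Suc j)" for i
    proof (induction i)
      case 0
      then show ?case using g(1)[of 0] k0 kSuc[of 0] by (intro exI[of _ 0]) simp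
    next
      case (Suc i)
      then obtain j where "k j \<le> i" "i < k (Suc j)" by blast
      then show ?case using g(1)[of "k (Suc j)"] kSuc[of "Suc j"]
        by (cases "Suc i = k (Suc j)") (auto intro: exI[of _ j] exI[of _ "Suc j"])
    qed
    then show ?thesis unfolding B_def by (auto, meson atLeastLessThan_iff)
  qed
  \<comment> \<open>The infinite union is the union of its initial stretches, which share a point of
    \<open>F 0\<close>.\<close>
  moreover have "(\<Union>i. F i) \<in> \<C>"
  proof -
    obtain x where x: "x \<in> F 0" using F(3)[of 0] by blast
    have "\<Union>((\<lambda>n. \<Union>i\<in>{0..<Suc n}. F i) ` UNIV) \<in> \<C>"
      using connectoid_chain[of S \<C> F 0, OF conn F(2,3)] x by (intro connectoid_Union[OF conn, of _ x]) auto
    moreover have "\<Union>((\<lambda>n. \<Union>i\<in>{0..<Suc n}. F i) ` UNIV) = (\<Union>i. F i)" by force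
    ultimately show ?thesis by simp
  qed
  ultimately show ?thesis unfolding necklace_def by blast
qed

section \<open>Normal trees from a choice of points\<close>

text \<open>
  In the application, \<open>\<mu> C\<close> is the part of the minor that contains the tree-least vertex of \<open>\<Union>C\<close>.
\<close>

locale pointed_connectoid =
  fixes S :: "'a set" and \<C> :: "'a set set" and U :: "'a set" and \<mu> :: "'a set \<Rightarrow> 'a"
  assumes conn: "connectoid S \<C>" and S_conn: "S \<in> \<C>" and S_ne: "S \<noteq> {}" and U_sub: "U \<subseteq> S"
    and mu_in: "\<And>C. C \<in> \<C> \<Longrightarrow> C \<noteq> {} \<Longrightarrow> \<mu> C \<in> C"
    and mu_finite: "\<And>u. u \<in> U \<Longrightarrow> finite {\<mu> C | C. C \<in> \<C> \<and> u \<in> C}"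
begin

section \<open>Components left after deleting a set\<close>

definition comp :: "'a set \<Rightarrow> 'a \<Rightarrow> 'a set" where
  "comp X s = \<Union>{C \<in> \<C>. s \<in> C \<and> C \<inter> X = {}}"

lemma comp_connected: "comp X s \<in> \<C>"
  unfolding comp_def by (rule connectoid_Union[OF conn, of _ s]) auto

lemma comp_subset: "comp X s \<subseteq> S"
  using comp_connected connectoid_subset[OF conn] by blast

lemma comp_disjoint: "comp X s \<inter> X = {}"
  by (auto simp: comp_def)

lemma comp_self: "s \<in> S \<Longrightarrow> s \<notin> X \<Longrightarrow> s \<in> comp X s"
  using connectoid_singleton[OF conn] by (fastforce simp: comp_def)

lemma comp_maximal: "C \<in> \<C> \<Longrightarrow> s \<in> C \<Longrightarrow> C \<inter> X = {} \<Longrightarrow> C \<subseteq> comp X s"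
  by (auto simp: comp_def)

lemma comp_antimono: "X \<subseteq> Y \<Longrightarrow> comp Y s \<subseteq> comp X s"
  by (auto simp: comp_def)

lemma comp_eq:
  assumes "t \<in> comp X s"
  shows "comp X t = comp X s"
proof
  show sub: "comp X s \<subseteq> comp X t"
    by (rule comp_maximal[OF comp_connected assms comp_disjoint])
  have "s \<in> comp X s" using assms by (auto simp: comp_def)
  with sub show "comp X t \<subseteq> comp X s"
    by (intro comp_maximal[OF comp_connected _ comp_disjoint]) auto
qed

section \<open>Finite links and the picking rule\<close>

definition link :: "'a set \<Rightarrow> 'a \<Rightarrow> 'a \<Rightarrow> 'a set" where
  "link X a b = (SOME F. F \<in> \<C> \<and> finite F \<and> F \<subseteq> comp X a \<and> a \<in> F \<and> b \<in> F)"

lemma link: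
  assumes "a \<in> comp X a" "b \<in> comp X a"
  shows "link X a b \<in> \<C> \<and> finite (link X a b) \<and> link X a b \<subseteq> comp X a \<and> a \<in> link X a b \<and> b \<in> link X a b"
  unfolding link_def
  by (rule someI_ex) (use connectoid_finite_link[OF conn comp_connected assms] in blast)

text \<open>Only the first \<open>i\<close> nodes are deleted, so along a branch both ends lie in
  the component in which the link is chosen. The link depends on the history alone, hence branches
  with a common beginning share their links.\<close>

definition link_at :: "'a list \<Rightarrow> nat \<Rightarrow> 'a set" where
  "link_at h i = link (set (take i h)) (h ! i) (h ! Suc i)"

text \<open>
  The odd steps of a branch process the earlier links in order of their index. Hence a point of a
  link cannot stay in the current component along an infinite branch.
\<close>

definition pick :: "'a list \<Rightarrow> 'a set \<Rightarrow> 'a" where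
  "pick h D = (if odd (length h) \<and> (\<exists>i. Suc i < length h \<and> link_at h i \<inter> D \<noteq> {})
     then SOME x. x \<in> link_at h (LEAST i. Suc i < length h \<and> link_at h i \<inter> D \<noteq> {}) \<inter> D
     else \<mu> D)"

lemma pick_even: "even (length h) \<Longrightarrow> pick h D = \<mu> D"
  by (simp add: pick_def)

text \<open>The least index of a link that meets \<open>D\<close> is at most \<open>n\<close>. So as
  long as link \<open>n\<close> meets the current component, late odd steps pick from the finitely
  many points of the links up to \<open>n\<close>.\<close>

lemma pick_odd:
  assumes "odd (length h)" "Suc n < length h" "link_at h n \<inter> D \<noteq> {}"
  shows "\<exists>i\<le>n. pick h D \<in> link_at h i \<inter> D"
proof -
  define Q where "Q i \<longleftrightarrow> Suc i < length h \<and> link_at h i \<inter> D \<noteq> {}" for i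
  have "Q n" using assms by (simp add: Q_def)
  then have least: "Q (LEAST i. Q i)" "(LEAST i. Q i) \<le> n"
    by (auto intro: LeastI Least_le)
  have "pick h D = (SOME x. x \<in> link_at h (LEAST i. Q i) \<inter> D)"
    using assms by (auto simp: pick_def Q_def)
  also have "\<dots> \<in> link_at h (LEAST i. Q i) \<inter> D"
    using least(1) by (intro someI_ex[of "\<lambda>x. x \<in> _"]) (auto simp: Q_def)
  finally show ?thesis using least(2) by blast
qed

lemma pick_in:
  assumes "D \<in> \<C>" "D \<noteq> {}"
  shows "pick h D \<in> D"
proof (cases "odd (length h) \<and> (\<exists>i. Suc i < length h \<and> link_at h i \<inter> D \<noteq> {})")
  case True
  then show ?thesis using pick_odd by blast
next
  case False
  then have "pick h D = \<mu> D" unfolding pick_def by argo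
  then show ?thesis using mu_in[OF assms] by simp
qed

text \<open>
  \<open>hist s n\<close> is the branch of the tree that is steered towards \<open>s\<close>. It carries no meaning after \<open>s\<close>
  itself has been picked, since \<open>comp\<close> is then empty.
\<close>

primrec hist :: "'a \<Rightarrow> nat \<Rightarrow> 'a list" where
  "hist s 0 = []"
| "hist s (Suc n) = hist s n @ [pick (hist s n) (comp (set (hist s n)) s)]"

definition step :: "'a \<Rightarrow> nat \<Rightarrow> 'a" where
  "step s n = pick (hist s n) (comp (set (hist s n)) s)"

lemma hist_Suc: "hist s (Suc n) = hist s n @ [step s n]"
  by (simp add: step_def)

declare hist.simps(2) [simp del]

lemma hist_map: "hist s n = map (step s) [0..<n]"
  by (induction n) (simp_all add: hist_Suc)

lemma length_hist [simp]: "length (hist s n) = n"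
  by (simp add: hist_map)

lemma set_hist: "set (hist s n) = step s ` {..<n}"
  by (auto simp: hist_map)

lemma set_hist_mono: "m \<le> n \<Longrightarrow> set (hist s m) \<subseteq> set (hist s n)"
  by (auto simp: set_hist)

lemma step_in:
  assumes "s \<in> S" "s \<notin> set (hist s n)"
  shows "step s n \<in> comp (set (hist s n)) s"
  unfolding step_def using comp_self[OF assms] comp_connected by (intro pick_in) auto

lemma step_notin: "s \<in> S \<Longrightarrow> s \<notin> set (hist s n) \<Longrightarrow> step s n \<notin> set (hist s n)"
  using step_in comp_disjoint by blast

text \<open>A pick depends only on the history and the current component, and \<open>s\<close> and
  \<open>t\<close> share their components up to stage \<open>n\<close>. Thus the branches agree
  including the node picked at stage \<open>n\<close>, whence the bound
  \<open>Suc n\<close>.\<close>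

lemma hist_cong:
  assumes "t \<in> comp (set (hist s n)) s"
  shows "m \<le> Suc n \<Longrightarrow> hist t m = hist s m"
proof (induction m)
  case (Suc m)
  then have "t \<in> comp (set (hist s m)) s"
    using assms comp_antimono[OF set_hist_mono[of m n s]] by auto
  from comp_eq[OF this] Suc show ?case by (simp add: hist.simps(2))
qed simp

lemma distinct_hist: "s \<in> S \<Longrightarrow> s \<notin> set (hist s n) \<Longrightarrow> distinct (hist s (Suc n))"
proof (induction n)
  case (Suc n)
  then have "distinct (hist s (Suc n))" by (simp add: hist_Suc)
  then show ?case using step_notin[OF Suc.prems] hist_Suc[of s "Suc n"] by simp
qed (simp add: hist_Suc)

section \<open>Vertices, levels and root paths\<close>

definition V :: "'a set" where
  "V = {v \<in> S. \<exists>n. v \<in> set (hist v n)}"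

text \<open>The shift by \<open>Suc\<close> gives the root level 0.\<close>

definition level :: "'a \<Rightarrow> nat" where
  "level v = (LEAST n. v \<in> set (hist v (Suc n)))"

definition P :: "'a \<Rightarrow> 'a list" where
  "P v = hist v (Suc (level v))"

lemma level:
  assumes "v \<in> V"
  shows "v \<notin> set (hist v (level v))" "step v (level v) = v"
proof -
  obtain n where "v \<in> set (hist v n)" using assms by (auto simp: V_def)
  then obtain m where "v \<in> set (hist v (Suc m))" by (cases n) auto
  then have *: "v \<in> set (hist v (Suc (level v)))" unfolding level_def by (rule LeastI)
  show "v \<notin> set (hist v (level v))"
  proof (cases "level v")
    case (Suc k)
    then show ?thesis using not_less_Least[of k "\<lambda>n. v \<in> set (hist v (Suc n))"] unfolding level_def by simp
  qed simp
  with * show "step v (level v) = v" by (auto simp: hist_Suc)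
qed

lemma P_eq: "v \<in> V \<Longrightarrow> P v = hist v (level v) @ [v]"
  using level by (simp add: P_def hist_Suc)

text \<open>The picked node lies in the component of \<open>s\<close>, so its own branch agrees with
  that of \<open>s\<close> up to and including this pick. It was not picked earlier, so its level is
  exactly \<open>n\<close>.\<close>

lemma step_node:
  assumes s: "s \<in> S" "s \<notin> set (hist s n)"
  shows "step s n \<in> V" "level (step s n) = n" "P (step s n) = hist s (Suc n)"
proof -
  let ?w = "step s n"
  have w: "?w \<in> comp (set (hist s n)) s" by (rule step_in[OF s])
  have eq: "hist ?w m = hist s m" if "m \<le> Suc n" for m using hist_cong[OF w that] .
  have mem: "?w \<in> set (hist ?w (Suc n))" using eq[of "Suc n"] by (simp add: hist_Suc)
  then show "?w \<in> V" using w comp_subset unfolding V_def by blast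
  have notin: "?w \<notin> set (hist ?w n)" using step_notin[OF s] eq[of n] by simp
  show l: "level ?w = n"
    unfolding level_def
  proof (rule Least_equality)
    fix m assume m: "?w \<in> set (hist ?w (Suc m))"
    show "n \<le> m"
    proof (rule ccontr)
      assume "\<not> n \<le> m"
      then have "set (hist ?w (Suc m)) \<subseteq> set (hist ?w n)" by (intro set_hist_mono) simp
      with m notin show False by blast
    qed
  qed (rule mem)
  then show "P ?w = hist s (Suc n)" unfolding P_def using eq by simp
qed

lemma V_subset: "V \<subseteq> S"
  by (auto simp: V_def)

lemma comp_empty: "s \<in> S \<Longrightarrow> comp {} s = S"
  using comp_maximal[OF S_conn, of s "{}"] comp_subset by blast

definition r :: 'a where
  "r = pick [] S"

lemma step_0: "s \<in> S \<Longrightarrow> step s 0 = r"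
  by (simp add: step_def r_def comp_empty)

text \<open>Every entry of \<open>P v\<close> was picked while \<open>v\<close> was still unpicked,
  so \<open>step_node\<close> applies and its position on the path is its level.\<close>

lemma level_in_P:
  assumes "v \<in> V" "u \<in> set (P v)"
  shows "u = step v (level u)" "v \<notin> set (hist v (level u))"
    "u \<in> V" "hist u (Suc (level u)) = hist v (Suc (level u))"
proof -
  obtain i where i: "i \<le> level v" "u = step v i"
    using assms by (auto simp: P_def set_hist less_Suc_eq_le)
  have v: "v \<notin> set (hist v i)" using level(1)[OF assms(1)] set_hist_mono[OF i(1)] by blast
  have "v \<in> S" using assms V_subset by blast
  from step_node[OF this v] i(2) have node: "u \<in> V" "level u = i" "P u = hist v (Suc i)" by auto
  then show "u = step v (level u)" "v \<notin> set (hist v (level u))" "u \<in> V"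
    using i v by auto
  show "hist u (Suc (level u)) = hist v (Suc (level u))" using node unfolding P_def by metis
qed

sublocale path_system V r P
proof
  obtain s where s: "s \<in> S" using S_ne by blast
  show "r \<in> V" "P r = [r]"
    using step_node[of s 0] s step_0[OF s] by (auto simp: hist_Suc)
next
  fix v assume v: "v \<in> V" "v \<noteq> r"
  then have vS: "v \<in> S" using V_subset by blast
  have "level v \<noteq> 0" using level(2)[OF v(1)] step_0[OF vS] v(2) by metis
  then obtain k where k: "level v = Suc k" by (cases "level v") auto
  have "v \<notin> set (hist v k)"
    using level(1)[OF v(1)] k set_hist_mono[of k "Suc k" v] by auto
  from step_node[OF vS this] show "\<exists>u\<in>V. P v = P u @ [v]"
    using P_eq[OF v(1)] k by metis
next
  fix v assume "v \<in> V"
  then show "distinct (P v)"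
    using distinct_hist[of v "level v"] level(1) V_subset unfolding P_def by blast
qed

section \<open>Weak normality\<close>

lemma common_ancestor_aux:
  assumes C: "C \<in> \<C>" "u \<in> C \<inter> V" "v \<in> C \<inter> V" and le: "level u \<le> level v"
  shows "\<exists>w\<in>C. w \<in> set (P u) \<and> w \<in> set (P v)"
proof (rule ccontr)
  assume not: "\<not> ?thesis"
  \<comment> \<open>As long as the histories agree, \<open>C\<close> avoids them, so
    \<open>C\<close> keeps \<open>u\<close> and \<open>v\<close> in one component and the next picks
    agree too. At the level of \<open>u\<close> this puts \<open>u\<close> itself on the path to
    \<open>v\<close>, a common ancestor in \<open>C\<close>.\<close>
  have "hist v (Suc n) = hist u (Suc n)" if "n \<le> level u" for n
    using that
  proof (induction n rule: less_induct)
    case (less n)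
    have eq: "hist v n = hist u n"
      using less by (cases n) auto
    have "set (hist u n) \<subseteq> set (P u)" "set (hist v n) \<subseteq> set (P v)"
      unfolding P_def using less.prems le by (auto intro!: set_hist_mono)
    with eq not have "C \<inter> set (hist u n) = {}" by auto
    then have "v \<in> comp (set (hist u n)) u"
      using comp_maximal[OF C(1), of u] C by blast
    then show ?case by (rule hist_cong) simp
  qed
  from this[of "level u"] have "hist v (Suc (level u)) = P u" by (simp add: P_def)
  moreover have "set (hist v (Suc (level u))) \<subseteq> set (P v)"
    unfolding P_def using le by (intro set_hist_mono) simp
  moreover have "u \<in> set (P u)" using P_eq C by simp
  ultimately have "u \<in> set (P u)" "u \<in> set (P v)" by auto
  with not C show False by blast
qed

lemma common_ancestor:
  assumes "C \<in> \<C>" "u \<in> C \<inter> V" "v \<in> C \<inter> V"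
  shows "\<exists>w\<in>C. w \<in> set (P u) \<and> w \<in> set (P v)"
  using common_ancestor_aux[OF assms] common_ancestor_aux[OF assms(1,3,2)]
  by (cases "level u \<le> level v") auto

text \<open>The component from which \<open>u\<close> was picked still contains \<open>v\<close> and
  avoids all nodes picked before \<open>u\<close>.\<close>

lemma connected_above:
  assumes v: "v \<in> V" and u: "u \<in> set (P v)"
  shows "\<exists>C\<in>\<C>. u \<in> C \<and> v \<in> C \<and> (\<nexists>w. w \<in> C \<and> w \<in> set (P u) \<and> w \<noteq> u)"
proof -
  note lv = level_in_P[OF v u]
  let ?C = "comp (set (hist v (level u))) v"
  have vS: "v \<in> S" using v V_subset by blast
  have "u \<in> ?C" using step_in[OF vS lv(2)] lv(1) by simp
  moreover have "v \<in> ?C" using comp_self[OF vS lv(2)] .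
  moreover have "w = u" if "w \<in> ?C" "w \<in> set (P u)" for w
  proof -
    have "hist u (level u) = hist v (level u)" using lv(4) by (simp add: hist_Suc)
    then show ?thesis using that comp_disjoint P_eq[OF lv(3)] by fastforce
  qed
  ultimately show ?thesis using comp_connected by blast
qed

lemma weak_normal: "weak_normal_tree S \<C> tree"
  unfolding weak_normal_tree_def tree_less_def
  using rooted_tree V_subset common_ancestor connected_above level_in_P(3)
  by (auto simp: tree_le_iff)

section \<open>Every element of \<open>U\<close> is picked\<close>

lemma U_subset_V: "U \<subseteq> V"
proof
  fix u assume u: "u \<in> U"
  show "u \<in> V"
  proof (rule ccontr)
    assume "u \<notin> V"
    then have alive: "u \<notin> set (hist u n)" for n using u U_sub by (auto simp: V_def)
    have uS: "u \<in> S" using u U_sub by blast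
    have "step u m \<noteq> step u n" if "m < n" for m n
      using step_notin[OF uS alive[of n]] that unfolding set_hist by (metis imageI lessThan_iff)
    then have "inj (step u)" by (metis injI linorder_neqE_nat)
    \<comment> \<open>At even stages the pick is the value of \<mu> at a component containing
      \<open>u\<close>; infinitely many distinct values contradict \<open>mu_finite\<close>.\<close>
    then have "inj (\<lambda>n. step u (2 * n))" unfolding inj_def by fastforce
    moreover have "range (\<lambda>n. step u (2 * n)) \<subseteq> {\<mu> C | C. C \<in> \<C> \<and> u \<in> C}"
      using comp_connected comp_self[OF uS alive] by (auto simp: step_def pick_even)
    ultimately show False
      using mu_finite[OF u] by (meson finite_imageD finite_subset infinite_UNIV_nat)
  qed
qed

section \<open>A necklace along each ray from the root\<close>

lemma ray_necklace:
  assumes R: "root_ray tree R"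
  shows "\<exists>N. necklace \<C> N \<and> range R \<subseteq> N"
proof -
  have inj: "inj R" and RV: "R n \<in> V" for n using R by (auto simp: root_ray_def)
  have RS: "R n \<in> S" for n using RV V_subset by blast
  have PR: "P (R n) = map R [0..<Suc n]" for n by (rule P_root_ray[OF R])
  have lev: "level (R n) = n" for n
    using arg_cong[OF PR[of n], of length] by (simp add: P_def)
  have "map (step (R m)) [0..<Suc m] = map R [0..<Suc m]" for m
    using PR[of m] lev[of m] unfolding P_def hist_map by simp
  \<comment> \<open>The branch steered towards \<open>R m\<close> runs along the ray up to
    \<open>R m\<close>.\<close>
  then have step: "step (R m) n = R n" if "n \<le> m" for m n
    using that by (auto simp: map_eq_conv simp del: upt_Suc)
  have hist: "hist (R m) n = map R [0..<n]" if "n \<le> m" for m n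
    using that step unfolding hist_map by simp
  \<comment> \<open>The component from which \<open>R n\<close> is picked; it contains the tail of
    the ray from \<open>R n\<close> on.\<close>
  define D where "D n = comp (R ` {..<n}) (R n)" for n
  have set_hist': "set (hist (R m) n) = R ` {..<n}" if "n \<le> m" for m n
    using hist[OF that] by auto
  have alive: "R m \<notin> R ` {..<n}" if "n \<le> m" for m n
    using inj that by (auto simp: inj_eq)
  have D: "D n = comp (R ` {..<n}) (R m)" if "n \<le> m" for m n
    using step_in[OF RS, of m n] alive[OF that] step[OF that] comp_eq
    unfolding D_def set_hist'[OF that] by metis
  have R_in_D: "R m \<in> D n" if "n \<le> m" for m n
    using D[OF that] comp_self[OF RS alive[OF that]] by simp
  have D_anti: "D m \<subseteq> D n" if "n \<le> m" for m n
    unfolding D[OF that] D_def[of m] using that by (intro comp_antimono) auto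
  define F where "F i = link (R ` {..<i}) (R i) (R (Suc i))" for i
  have F: "F i \<in> \<C> \<and> finite (F i) \<and> F i \<subseteq> D i \<and> R i \<in> F i \<and> R (Suc i) \<in> F i" for i
    unfolding F_def D_def using R_in_D[of i i] R_in_D[of i "Suc i"] by (intro link) (auto simp: D_def)
  have link_at: "link_at (map R [0..<m]) i = F i" if "Suc i < m" for i m
    using that by (simp add: link_at_def F_def take_map atLeast0LessThan)
  have R_pick: "R m = pick (map R [0..<m]) (D m)" for m
    using step[of m m] hist[of m m] set_hist'[of m m] by (simp add: step_def D_def)
  have escape: "\<exists>m. x \<notin> D m" if x: "x \<in> F n" for x n
  proof (rule ccontr)
    assume "\<not> ?thesis"
    then have xD: "\<And>m. x \<in> D m" by blast
    \<comment> \<open>The index is odd and exceeds \<open>Suc n\<close>, so link \<open>n\<close> is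
      already available. As \<open>x\<close> keeps it alive, the pick falls into the finite union of
      the links up to \<open>n\<close>, which is impossible for infinitely many nodes of an
      injective ray.\<close>
    have "R (2 * k + n * 2 + 3) \<in> (\<Union>i\<le>n. F i)" for k
    proof -
      let ?m = "2 * k + n * 2 + 3"
      have "\<exists>i\<le>n. pick (map R [0..<?m]) (D ?m) \<in> link_at (map R [0..<?m]) i \<inter> D ?m"
        using xD[of ?m] x link_at[of n ?m] by (intro pick_odd) auto
      then obtain i where i: "i \<le> n" "R ?m \<in> link_at (map R [0..<?m]) i"
        unfolding R_pick[of ?m, symmetric] by blast
      then have "R ?m \<in> F i" using link_at[of i ?m] by simp
      with i show ?thesis by blast
    qed
    then have "range (\<lambda>k. R (2 * k + n * 2 + 3)) \<subseteq> (\<Union>i\<le>n. F i)" by blast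
    moreover have "finite (\<Union>i\<le>n. F i)" using F by blast
    moreover have "inj (\<lambda>k. R (2 * k + n * 2 + 3))" using inj unfolding inj_def by fastforce
    ultimately show False by (meson finite_imageD finite_subset infinite_UNIV_nat)
  qed
  \<comment> \<open>All links from index \<open>m\<close> on lie in \<open>D m\<close>, so a point
    outside \<open>D m\<close> is only in earlier ones.\<close>
  have "finite {i. x \<in> F i}" for x
  proof (cases "\<exists>n. x \<in> F n")
    case True
    then obtain m where "x \<notin> D m" using escape by blast
    moreover have "F i \<subseteq> D m" if "m \<le> i" for i using F[of i] D_anti[OF that] by blast
    ultimately have "x \<notin> F i" if "m \<le> i" for i using that by blast
    then have "{i. x \<in> F i} \<subseteq> {..<m}" by (auto simp: not_le[symmetric])
    then show ?thesis by (rule finite_subset) simp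
  qed simp
  moreover have "F i \<inter> F (Suc i) \<noteq> {}" for i using F[of i] F[of "Suc i"] by blast
  ultimately have "necklace \<C> (\<Union>i. F i)" using F by (intro necklace_chain[OF conn]) auto
  moreover have "range R \<subseteq> (\<Union>i. F i)" using F by blast
  ultimately show ?thesis by blast
qed

lemma normal_tree_exists: "\<exists>T. normal_tree S \<C> T \<and> U \<subseteq> verts T"
proof (intro exI conjI)
  show "normal_tree S \<C> tree"
    unfolding normal_tree_def using weak_normal ray_necklace
    by (metis Diff_eq_empty_iff finite.emptyI)
  show "U \<subseteq> verts tree" using U_subset_V by simp
qed

end

section \<open>Application to the minor\<close>

theorem corollary3p4:
  fixes S U :: "'a set" and \<C> :: "'a set set"
    and S'' :: "'a set set" and \<C>'' :: "'a set set set"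
  assumes "connectoid S \<C>"
    and "U \<subseteq> S"
    and "\<exists>T. normal_tree S \<C> T \<and> U \<subseteq> verts T"
    and "is_minor S'' \<C>'' S \<C>"
    and "connected_connectoid S'' \<C>''"
    and "S'' \<noteq> {}"
  shows "\<exists>T''. normal_tree S'' \<C>'' T'' \<and> {s \<in> S''. s \<inter> U \<noteq> {}} \<subseteq> verts T''"
proof -
  obtain T where T: "weak_normal_tree S \<C> T" and U: "U \<subseteq> verts T"
    using assms(3) by (auto simp: normal_tree_def)
  then have tree: "rooted_tree T" by (simp add: weak_normal_tree_def)
  obtain S' \<C>' where part: "partition_on S' S''" and sub: "\<C>' \<subseteq> \<C>"
    and C'': "\<C>'' = contracted_sets \<C>' S''"
    using assms(4) by (auto simp: is_minor_def subconnectoid_def)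
  define least where "least D s \<longleftrightarrow> (\<exists>m\<in>s. \<forall>v\<in>\<Union>D \<inter> verts T. tree_le T m v)"
    for D :: "'a set set" and s
  \<comment> \<open>If the union of \<open>D\<close> misses the tree, any element of
    \<open>D\<close> will do.\<close>
  define \<mu> where "\<mu> D = (SOME s. s \<in> D \<and> (\<Union>D \<inter> verts T \<noteq> {} \<longrightarrow> least D s))" for D
  have mu: "\<mu> D \<in> D \<and> (\<Union>D \<inter> verts T \<noteq> {} \<longrightarrow> least D (\<mu> D))"
    if D: "D \<in> \<C>''" "D \<noteq> {}" for D
    unfolding \<mu>_def
  proof (rule someI_ex)
    have "\<Union>D \<in> \<C>" using D sub C'' by (auto simp: contracted_sets_def)
    from weak_normal_tree_connected_least[OF T this]
    show "\<exists>s. s \<in> D \<and> (\<Union>D \<inter> verts T \<noteq> {} \<longrightarrow> least D s)"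
      using D(2) unfolding least_def by blast
  qed
  interpret pointed_connectoid S'' \<C>'' "{s \<in> S''. s \<inter> U \<noteq> {}}" \<mu>
  proof
    show "connectoid S'' \<C>''" "S'' \<in> \<C>''"
      using assms(5) by (auto simp: connected_connectoid_def)
    show "S'' \<noteq> {}" by fact
    show "\<mu> D \<in> D" if "D \<in> \<C>''" "D \<noteq> {}" for D using mu that by blast
  next
    fix s assume "s \<in> {s \<in> S''. s \<inter> U \<noteq> {}}"
    then obtain u where u: "u \<in> s" "u \<in> verts T" using U by blast
    \<comment> \<open>Since \<open>u\<close> lies in the union of \<open>D\<close>, the least vertex
      of that union is below \<open>u\<close>, and \<mu> selects a part containing it.\<close>
    have "{\<mu> D | D. D \<in> \<C>'' \<and> s \<in> D} \<subseteq> (\<Union>m\<in>{m. tree_le T m u}. {t \<in> S''. m \<in> t})"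
    proof clarify
      fix D assume D: "D \<in> \<C>''" "s \<in> D"
      then have "D \<subseteq> S''" by (simp add: C'' contracted_sets_def)
      moreover have "\<mu> D \<in> D" "least D (\<mu> D)" using mu[OF D(1)] D u by blast+
      ultimately show "\<mu> D \<in> (\<Union>m\<in>{m. tree_le T m u}. {t \<in> S''. m \<in> t})"
        using u D(2) unfolding least_def by blast
    qed
    \<comment> \<open>The parts are disjoint, so at most one contains \<open>m\<close>.\<close>
    moreover have "finite {t \<in> S''. m \<in> t}" for m
    proof (rule finite_subset)
      show "{t \<in> S''. m \<in> t} \<subseteq> {THE t. t \<in> S'' \<and> m \<in> t}"
        using part by (auto simp: partition_on_def disjoint_def intro!: the_equality[symmetric])
    qed simp
    ultimately show "finite {\<mu> D | D. D \<in> \<C>'' \<and> s \<in> D}"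
      using rooted_tree_finite_below[OF tree] by (meson finite_UN_I finite_subset)
  qed auto
  show ?thesis by (rule normal_tree_exists)
qed

end
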